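(* Let $S$ be a commutative semiring with a nonzero identity and let $M$ be a unital $S$-semimodule which has the annihilator condition. If the graph $\Gamma_{(\operatorname{Id}(S),\operatorname{Ann})}(M)$ is non-empty, where $\operatorname{Id}(S)$ is the commutative semigroup of ideals of $S$ under intersection and $\operatorname{Ann}:M\to\operatorname{Id}(S)$ is the function $x\mapsto\operatorname{Ann}(x)$, then it is a connected graph whose diameter is at most $3$.
   Context: A commutative semiring with identity $(S,+,\cdot,0,1)$ consists of commutative monoids $(S,+,0)$ and $(S,\cdot,1)$ with multiplication distributing over addition and $0\cdot s=0$ for all $s$. A unital $S$-semimodule $M$ is a commutative additive monoid with a bi-additive action of $S$ satisfying $(st)m=s(tm)$, $1m=m$, $0_S m=0_M$ and $s0_M=0_M$. An ideal of $S$ is a non-empty subset closed under addition and under multiplication by elements of $S$. The set $\operatorname{Id}(S)$ of all ideals of $S$ is a commutative semigroup under $\cap$ whose zero (absorbing element) is the ideal $(0)$. For a subset $N\subseteq M$, $\operatorname{Ann}(N)=\{s\in S: sN=0\}$; write $\operatorname{Ann}(x)=\operatorname{Ann}(\{x\})$ and $\operatorname{Ann}(x,y)=\operatorname{Ann}(\{x,y\})$. $M$ has the annihilator condition if for all $x,y\in M$ there is a $z\in M$ such that $\operatorname{Ann}(x,y)=\operatorname{Ann}(z)$. For a non-empty set $X$, a commutative semigroup with zero $(T,\cdot,0)$ and a function $f:X\to T$, the simple graph $\Gamma_{(T,f)}(X)$ is defined as follows. An element $x\in X$ is a vertex if $f(x)\neq 0$ and there is a $y\in X$ with $y\neq x$,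 $f(y)\neq 0$ and $f(x)\cdot f(y)=0$. For $x,y\in X$, $\{x,y\}$ is an edge if $x\neq y$, $f(x)\neq 0$, $f(y)\neq 0$ and $f(x)\cdot f(y)=0$. The graph is non-empty if it has at least one vertex; its diameter is the greatest distance between any two vertices, distance being the number of edges in a shortest path. *)

theory Defs
  imports "Graph_Theory.Graph_Theory"
begin

text \<open>Commutative semirings with nonzero identity are the type class \<open>comm_semiring_1\<close>,
  which contains \<open>0 \<noteq> 1\<close> and the absorption law and requires no cancellation.\<close>

locale semimodule =
  fixes scale :: "'s::comm_semiring_1 \<Rightarrow> 'm::comm_monoid_add \<Rightarrow> 'm"  (infixr \<open>*s\<close> 75)
  assumes scale_right_distrib: "a *s (x + y) = a *s x + a *s y"
    and scale_left_distrib: "(a + b) *s x = a *s x + b *s x"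
    and scale_scale: "(a * b) *s x = a *s (b *s x)"
    and scale_one: "1 *s x = x"
    and scale_zero_left: "0 *s x = 0"
    and scale_zero_right: "a *s 0 = 0"

definition semiring_ideals :: "'s::comm_semiring_1 set set" where
  "semiring_ideals =
    {I. I \<noteq> {} \<and> (\<forall>a\<in>I. \<forall>b\<in>I. a + b \<in> I) \<and> (\<forall>s. \<forall>a\<in>I. s * a \<in> I)}"

definition Ann :: "('s::comm_semiring_1 \<Rightarrow> 'm::comm_monoid_add \<Rightarrow> 'm) \<Rightarrow> 'm set \<Rightarrow> 's set" where
  "Ann scale N = {s. \<forall>x\<in>N. scale s x = 0}"

definition annihilator_condition ::
    "('s::comm_semiring_1 \<Rightarrow> 'm::comm_monoid_add \<Rightarrow> 'm) \<Rightarrow> bool" where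
  "annihilator_condition scale \<longleftrightarrow> (\<forall>x y. \<exists>z. Ann scale {x, y} = Ann scale {z})"

locale comm_semigroup_with_zero =
  fixes T :: "'t set" and prd :: "'t \<Rightarrow> 't \<Rightarrow> 't" and zero :: 't
  assumes mult_closed: "a \<in> T \<Longrightarrow> b \<in> T \<Longrightarrow> prd a b \<in> T"
    and mult_assoc: "a \<in> T \<Longrightarrow> b \<in> T \<Longrightarrow> c \<in> T \<Longrightarrow> prd (prd a b) c = prd a (prd b c)"
    and mult_commute: "a \<in> T \<Longrightarrow> b \<in> T \<Longrightarrow> prd a b = prd b a"
    and zero_closed: "zero \<in> T"
    and mult_zero: "a \<in> T \<Longrightarrow> prd zero a = zero"

text \<open>Following the library, an undirected edge \<open>{x, y}\<close> is the pair of arcs \<open>(x, y)\<close>, \<open>(y, x)\<close>.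
  The graph depends on the semigroup only through its operation and its zero, so the carrier is
  not an argument.\<close>

definition Gamma :: "('t \<Rightarrow> 't \<Rightarrow> 't) \<Rightarrow> 't \<Rightarrow> ('x \<Rightarrow> 't) \<Rightarrow> 'x set \<Rightarrow> 'x pair_pre_digraph" where
  "Gamma prd zero f X =
    \<lparr>pverts = {x \<in> X. f x \<noteq> zero \<and> (\<exists>y\<in>X. y \<noteq> x \<and> f y \<noteq> zero \<and> prd (f x) (f y) = zero)},
     parcs = {(x, y). x \<in> X \<and> y \<in> X \<and> x \<noteq> y \<and> f x \<noteq> zero \<and> f y \<noteq> zero \<and>
       prd (f x) (f y) = zero}\<rparr>"

lemma (in comm_semigroup_with_zero) pair_bidirected_digraph_Gamma:
  assumes "f ` X \<subseteq> T"
  shows "pair_bidirected_digraph (Gamma prd zero f X)"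
proof -
  have comm: "prd (f x) (f y) = prd (f y) (f x)" if "x \<in> X" "y \<in> X" for x y
    using that assms by (intro mult_commute) auto
  have sym: "(y, x) \<in> parcs (Gamma prd zero f X)" if "(x, y) \<in> parcs (Gamma prd zero f X)" for x y
    using that comm[of x y] unfolding Gamma_def by auto
  have fst: "x \<in> pverts (Gamma prd zero f X)" if "(x, y) \<in> parcs (Gamma prd zero f X)" for x y
    using that unfolding Gamma_def pair_pre_digraph.simps mem_Collect_eq prod.case by metis
  show ?thesis
  proof
    show "fst e \<in> pverts (Gamma prd zero f X)" if "e \<in> parcs (Gamma prd zero f X)" for e
      using that fst by (cases e) simp
    show "snd e \<in> pverts (Gamma prd zero f X)" if "e \<in> parcs (Gamma prd zero f X)" for e
      using that fst sym by (metis prod.collapse)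
    show "symmetric (Gamma prd zero f X)"
      unfolding symmetric_def with_proj_simps by (rule symI) (rule sym)
    show "fst e \<noteq> snd e" if "e \<in> parcs (Gamma prd zero f X)" for e
      using that by (cases e) (simp add: Gamma_def)
  qed
qed

lemma comm_semigroup_with_zero_semiring_ideals:
  "comm_semigroup_with_zero semiring_ideals (\<inter>) {0 :: 's::comm_semiring_1}"
proof
  have zero_in: "0 \<in> I" if "I \<in> semiring_ideals" for I :: "'s set"
  proof -
    from that obtain a where "a \<in> I" by (auto simp: semiring_ideals_def)
    with that have "0 * a \<in> I" by (auto simp only: semiring_ideals_def mem_Collect_eq)
    then show ?thesis by simp
  qed
  show "I \<inter> J \<in> semiring_ideals" if "I \<in> semiring_ideals" "J \<in> semiring_ideals" for I J :: "'s set"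
    using that zero_in[OF that(1)] zero_in[OF that(2)] by (auto simp: semiring_ideals_def)
  show "{0} \<inter> I = {0}" if "I \<in> semiring_ideals" for I :: "'s set"
    using zero_in[OF that] by auto
qed (auto simp: semiring_ideals_def)

lemma (in semimodule) Ann_in_semiring_ideals: "Ann scale N \<in> semiring_ideals"
proof -
  have "0 \<in> Ann scale N" by (simp add: Ann_def scale_zero_left)
  then show ?thesis
    by (auto simp: semiring_ideals_def Ann_def scale_left_distrib scale_scale scale_zero_right)
qed

definition annihilator_graph ::
    "('s::comm_semiring_1 \<Rightarrow> 'm::comm_monoid_add \<Rightarrow> 'm) \<Rightarrow> 'm pair_pre_digraph" where
  "annihilator_graph scale = Gamma (\<inter>) {0} (\<lambda>x. Ann scale {x}) UNIV"

text \<open>With unit weights the cost of a walk is its number of edges.\<close>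

definition graph_distance :: "('a, 'b) pre_digraph \<Rightarrow> 'a \<Rightarrow> 'a \<Rightarrow> ereal" where
  "graph_distance G u v = wf_digraph.\<mu> G (\<lambda>_. 1) u v"

definition diameter :: "('a, 'b) pre_digraph \<Rightarrow> ereal" where
  "diameter G = (SUP u\<in>verts G. SUP v\<in>verts G. graph_distance G u v)"

lemma (in wf_digraph) graph_distance_eq_shortest_apath:
  "graph_distance G u v = (INF p\<in>{p. apath u p v}. ereal (length p))"
proof -
  have cost: "awalk_cost (\<lambda>_. 1) p = length p" for p
    by (induction p) auto
  have "(INF p\<in>{p. awalk u p v}. ereal (length p)) = (INF p\<in>{p. apath u p v}. ereal (length p))"
  proof (rule INF_eq)
    fix p assume "p \<in> {p. awalk u p v}"
    then have p: "awalk u p v" by simp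
    have "ereal (length (awalk_to_apath p)) \<le> length p"
      using awalk_to_path_no_neg_cyc_cost[OF p, of "\<lambda>_. 1"] by (simp add: cost)
    with apath_awalk_to_apath[OF p]
    show "\<exists>q\<in>{p. apath u p v}. ereal (length q) \<le> ereal (length p)" by auto
  qed (auto intro: awalkI_apath)
  then show ?thesis
    by (simp add: graph_distance_def \<mu>_def cost)
qed

end

theory Submission
  imports Defs
begin

text \<open>The argument takes place in the semigroup of values of the map \<open>f\<close> that defines
  \<open>\<Gamma>\<close>; for semimodules \<open>f\<close> is \<open>x \<mapsto> Ann(x)\<close>. Let \<open>x\<close>, \<open>y\<close> be vertices and choose
  neighbours \<open>x'\<close> of \<open>x\<close> and \<open>y'\<close> of \<open>y\<close>. If \<open>f x' \<cdot> f y' = 0\<close>, then \<open>x, x', y', y\<close> is a walk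
  after deletion of repeated neighbours. Otherwise \<open>Ann(x', y') = Ann(x') \<inter> Ann(y')\<close> and the
  annihilator condition make the product \<open>f x' \<cdot> f y'\<close> a value \<open>f w\<close>. It is nonzero, and as a
  multiple of both \<open>f x'\<close> and \<open>f y'\<close> it annihilates \<open>f x\<close> and \<open>f y\<close>; hence \<open>x, w, y\<close> is a
  walk, again up to repetitions. Thus any two vertices are joined by a walk with at most three
  edges (\<open>Gamma_awalk_length_le_3\<close>), which gives connectedness and the bound on the diameter at
  once (\<open>connected_diameter_le\<close>).\<close>

lemma (in wf_digraph) connected_diameter_le:
  assumes "verts G \<noteq> {}"
    and walk: "\<And>u v. u \<in> verts G \<Longrightarrow> v \<in> verts G \<Longrightarrow> \<exists>p. awalk u p v \<and> length p \<le> n"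
  shows "Digraph_Component.connected G \<and> diameter G \<le> ereal n"
proof
  have "strongly_connected G"
    using assms by (intro strongly_connectedI) (auto simp: reachable_awalk)
  then show "Digraph_Component.connected G"
    unfolding Digraph_Component.connected_def
    by (auto simp: strongly_connected_def intro: reachable_mk_symmetricI)
  have cost: "awalk_cost (\<lambda>_. 1) p = length p" for p
    by (induction p) auto
  have "graph_distance G u v \<le> ereal n" if uv: "u \<in> verts G" "v \<in> verts G" for u v
  proof -
    from walk[OF uv] obtain p where p: "awalk u p v" "length p \<le> n" by blast
    have "graph_distance G u v \<le> ereal (awalk_cost (\<lambda>_. 1) p)"
      unfolding graph_distance_def using p(1) by (rule min_cost_le_walk_cost)
    also have "\<dots> \<le> ereal n" using p(2) by (simp add: cost)
    finally show ?thesis .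
  qed
  then show "diameter G \<le> ereal n"
    unfolding diameter_def by (intro SUP_least)
qed

context comm_semigroup_with_zero
begin

text \<open>Elements with nonzero values and product zero are adjacent only if they are distinct, and in
  a semigroup with nilpotents they may coincide. Admitting the empty walk absorbs that case, so
  that the construction of longer walks need not compare elements.\<close>

lemma Gamma_awalk_step:
  assumes f: "f ` X \<subseteq> T"
    and a: "a \<in> pverts (Gamma prd zero f X)"
    and b: "b \<in> X" "f b \<noteq> zero" and ab: "prd (f a) (f b) = zero"
  obtains p where "pre_digraph.awalk (Gamma prd zero f X) a p b" "length p \<le> 1"
proof -
  interpret G: pair_bidirected_digraph "Gamma prd zero f X"
    using f by (rule pair_bidirected_digraph_Gamma)
  show thesis
  proof (cases "a = b")
    case True
    with a have "G.awalk a [] b"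
      by (simp add: G.awalk_Nil_iff)
    then show thesis by (rule that) simp
  next
    case False
    with a b ab have "(a, b) \<in> parcs (Gamma prd zero f X)"
      by (auto simp: Gamma_def)
    then have "G.awalk a [(a, b)] b"
      using G.arc_implies_awalk[of "(a, b)"] by simp
    then show thesis by (rule that) simp
  qed
qed

text \<open>The hypothesis \<open>closed\<close> is the annihilator condition for a general value map. It replaces
  the two chosen neighbours by one element annihilating both ends whenever the product of their
  values is nonzero.\<close>

lemma Gamma_awalk_length_le_3:
  assumes f: "f ` X \<subseteq> T"
    and closed: "\<And>x y. x \<in> X \<Longrightarrow> y \<in> X \<Longrightarrow> \<exists>z\<in>X. f z = prd (f x) (f y)"
    and x: "x \<in> pverts (Gamma prd zero f X)" and y: "y \<in> pverts (Gamma prd zero f X)"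
  shows "\<exists>p. pre_digraph.awalk (Gamma prd zero f X) x p y \<and> length p \<le> 3"
proof -
  interpret G: pair_bidirected_digraph "Gamma prd zero f X"
    using f by (rule pair_bidirected_digraph_Gamma)
  from x obtain x' where x': "x' \<in> X" "f x' \<noteq> zero" and xx': "prd (f x) (f x') = zero"
    by (auto simp: Gamma_def)
  from y obtain y' where y': "y' \<in> X" "f y' \<noteq> zero" and yy': "prd (f y) (f y') = zero"
    by (auto simp: Gamma_def)
  have X: "x \<in> X" "y \<in> X" "f y \<noteq> zero"
    using x y by (auto simp: Gamma_def)
  have T: "f x \<in> T" "f x' \<in> T" "f y \<in> T" "f y' \<in> T"
    using f X x'(1) y'(1) by auto
  have y'y: "prd (f y') (f y) = zero"
    using yy' mult_commute T(3,4) by metis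
  show ?thesis
  proof (cases "prd (f x') (f y') = zero")
    case True
    obtain p where p: "G.awalk x p x'" "length p \<le> 1"
      using Gamma_awalk_step[OF f x x' xx'] .
    obtain q where q: "G.awalk x' q y'" "length q \<le> 1"
      using Gamma_awalk_step[OF f _ y' True] G.awalk_last_in_verts[OF p(1)] by auto
    obtain r where r: "G.awalk y' r y" "length r \<le> 1"
      using Gamma_awalk_step[OF f _ X(2,3) y'y] G.awalk_last_in_verts[OF q(1)] by auto
    have "G.awalk x (p @ q @ r) y"
      by (intro G.awalk_appendI[OF p(1)] G.awalk_appendI[OF q(1)] r(1))
    moreover have "length (p @ q @ r) \<le> 3"
      using p(2) q(2) r(2) by simp
    ultimately show ?thesis by blast
  next
    case False
    obtain w where w: "w \<in> X" "f w = prd (f x') (f y')"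
      using closed[OF x'(1) y'(1)] by blast
    have "prd (f x) (f w) = prd (prd (f x) (f x')) (f y')"
      using T by (simp add: w(2) mult_assoc)
    then have xw: "prd (f x) (f w) = zero"
      using T by (simp add: xx' mult_zero)
    have "prd (f w) (f y) = prd (f x') zero"
      using T by (simp add: w(2) mult_assoc y'y)
    then have wy: "prd (f w) (f y) = zero"
      using T mult_commute[OF T(2) zero_closed] by (simp add: mult_zero)
    have w0: "f w \<noteq> zero"
      using False w(2) by simp
    obtain p where p: "G.awalk x p w" "length p \<le> 1"
      using Gamma_awalk_step[OF f x w(1) w0 xw] .
    obtain q where q: "G.awalk w q y" "length q \<le> 1"
      using Gamma_awalk_step[OF f _ X(2,3) wy] G.awalk_last_in_verts[OF p(1)] by auto
    have "G.awalk x (p @ q) y"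
      by (rule G.awalk_appendI[OF p(1) q(1)])
    moreover have "length (p @ q) \<le> 3"
      using p(2) q(2) by simp
    ultimately show ?thesis by blast
  qed
qed

end

theorem corollary3p7:
  fixes scale :: "'s::comm_semiring_1 \<Rightarrow> 'm::comm_monoid_add \<Rightarrow> 'm"
  assumes "semimodule scale"
    and "annihilator_condition scale"
    and "pverts (annihilator_graph scale) \<noteq> {}"
  shows "Digraph_Component.connected (annihilator_graph scale) \<and> diameter (annihilator_graph scale) \<le> 3"
proof -
  interpret semimodule scale by fact
  interpret ideals: comm_semigroup_with_zero "semiring_ideals :: 's set set" "(\<inter>)" "{0}"
    by (rule comm_semigroup_with_zero_semiring_ideals)
  have f: "range (\<lambda>x. Ann scale {x}) \<subseteq> semiring_ideals"
    using Ann_in_semiring_ideals by blast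
  interpret G: pair_bidirected_digraph "annihilator_graph scale"
    unfolding annihilator_graph_def using f by (rule ideals.pair_bidirected_digraph_Gamma)
  have closed: "\<exists>z\<in>UNIV. Ann scale {z} = Ann scale {x} \<inter> Ann scale {y}" for x y
  proof -
    have "Ann scale {x, y} = Ann scale {x} \<inter> Ann scale {y}"
      by (auto simp: Ann_def)
    with \<open>annihilator_condition scale\<close> show ?thesis
      unfolding annihilator_condition_def by (metis UNIV_I)
  qed
  have "\<exists>p. G.awalk u p v \<and> length p \<le> 3"
    if "u \<in> pverts (annihilator_graph scale)" "v \<in> pverts (annihilator_graph scale)" for u v
    using ideals.Gamma_awalk_length_le_3[OF f closed] that
    unfolding annihilator_graph_def by blast
  then show ?thesis
    using G.connected_diameter_le[of 3] assms(3) by simp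
qed

end
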